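(* Let $P(\lambda)=\sum_{i=0}^m A_i\lambda^i$ be an $n\times n$ quaternion matrix polynomial of degree $m$, with $A_0,\dots,A_m\in M_n(\mathbb{H})$ and $A_m\neq0$. Let $a\in\mathbb{C}$, $r>0$, and let $\Omega=B(a;r)=\{q\in\mathbb{H}:|q-a|<r\}$ be the open ball in $\mathbb{H}$ centered at $a$ of radius $r$. Then $P(\lambda)$ is stable with respect to $\Omega$ if and only if $P(\lambda)$ is stable with respect to $\Omega\cap\mathbb{C}$.
   Context: $\mathbb{H}$ denotes the real quaternions with modulus $|\cdot|$, and $\mathbb{C}=\{a_0+a_1 i\}\subseteq\mathbb{H}$. $M_n(\mathbb{H})$ is the set of $n\times n$ quaternion matrices, $\mathbb{H}^n$ the space of quaternion column vectors, and $z^*$ the conjugate transpose. For $S\subseteq\mathbb{H}$, $P(\lambda)=\sum_{i=0}^m A_i\lambda^i$ is stable with respect to $S$ if for every nonzero $y\in\mathbb{H}^n$ and every $\mu\in S$ there is a nonzero $z\in\mathbb{H}^n$ with $\sum_{i=0}^m z^*A_i y\mu^i\neq 0$. *)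

theory Defs
  imports "HOL-Analysis.Analysis"
begin

section \<open>The real quaternions\<close>

text \<open>The term \<open>Quat a b c d\<close> stands for $a + b i + c j + d k$.\<close>

datatype quat = Quat (qre: real) (qim1: real) (qim2: real) (qim3: real)

lemma quat_eq_iff:
  "x = y \<longleftrightarrow> qre x = qre y \<and> qim1 x = qim1 y \<and> qim2 x = qim2 y \<and> qim3 x = qim3 y"
  by (auto intro: quat.expand)

instantiation quat :: ring_1
begin

definition "0 = Quat 0 0 0 0"
definition "1 = Quat 1 0 0 0"
definition "x + y = Quat (qre x + qre y) (qim1 x + qim1 y) (qim2 x + qim2 y) (qim3 x + qim3 y)"
definition "- x = Quat (- qre x) (- qim1 x) (- qim2 x) (- qim3 x)"
definition "x - y = Quat (qre x - qre y) (qim1 x - qim1 y) (qim2 x - qim2 y) (qim3 x - qim3 y)"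
definition "x * y = Quat
  (qre x * qre y - qim1 x * qim1 y - qim2 x * qim2 y - qim3 x * qim3 y)
  (qre x * qim1 y + qim1 x * qre y + qim2 x * qim3 y - qim3 x * qim2 y)
  (qre x * qim2 y - qim1 x * qim3 y + qim2 x * qre y + qim3 x * qim1 y)
  (qre x * qim3 y + qim1 x * qim2 y - qim2 x * qim1 y + qim3 x * qre y)"

instance
  by standard
    (simp_all add: quat_eq_iff zero_quat_def one_quat_def plus_quat_def uminus_quat_def
      minus_quat_def times_quat_def algebra_simps)

end

lemma quat_sel_simps [simp]:
  "qre 0 = 0" "qim1 0 = 0" "qim2 0 = 0" "qim3 0 = 0"
  "qre 1 = 1" "qim1 1 = 0" "qim2 1 = 0" "qim3 1 = 0"
  "qre (x + y) = qre x + qre y" "qim1 (x + y) = qim1 x + qim1 y"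
  "qim2 (x + y) = qim2 x + qim2 y" "qim3 (x + y) = qim3 x + qim3 y"
  "qre (- x) = - qre x" "qim1 (- x) = - qim1 x" "qim2 (- x) = - qim2 x" "qim3 (- x) = - qim3 x"
  "qre (x - y) = qre x - qre y" "qim1 (x - y) = qim1 x - qim1 y"
  "qim2 (x - y) = qim2 x - qim2 y" "qim3 (x - y) = qim3 x - qim3 y"
  "qre (x * y) = qre x * qre y - qim1 x * qim1 y - qim2 x * qim2 y - qim3 x * qim3 y"
  "qim1 (x * y) = qre x * qim1 y + qim1 x * qre y + qim2 x * qim3 y - qim3 x * qim2 y"
  "qim2 (x * y) = qre x * qim2 y - qim1 x * qim3 y + qim2 x * qre y + qim3 x * qim1 y"
  "qim3 (x * y) = qre x * qim3 y + qim1 x * qim2 y - qim2 x * qim1 y + qim3 x * qre y"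
  by (simp_all add: zero_quat_def one_quat_def plus_quat_def uminus_quat_def
      minus_quat_def times_quat_def)

instantiation quat :: real_algebra_1
begin

definition "r *\<^sub>R x = Quat (r * qre x) (r * qim1 x) (r * qim2 x) (r * qim3 x)"

instance
  by standard (simp_all add: quat_eq_iff scaleR_quat_def algebra_simps)

end

lemma quat_scaleR_simps [simp]:
  "qre (r *\<^sub>R x) = r * qre x" "qim1 (r *\<^sub>R x) = r * qim1 x"
  "qim2 (r *\<^sub>R x) = r * qim2 x" "qim3 (r *\<^sub>R x) = r * qim3 x"
  by (simp_all add: scaleR_quat_def)

definition qcnj :: "quat \<Rightarrow> quat"
  where "qcnj x = Quat (qre x) (- qim1 x) (- qim2 x) (- qim3 x)"

lemma qcnj_simps [simp]:
  "qre (qcnj x) = qre x" "qim1 (qcnj x) = - qim1 x"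
  "qim2 (qcnj x) = - qim2 x" "qim3 (qcnj x) = - qim3 x"
  by (simp_all add: qcnj_def)

lemma quat_sum_squares_eq_0_iff:
  "(qre x)\<^sup>2 + (qim1 x)\<^sup>2 + (qim2 x)\<^sup>2 + (qim3 x)\<^sup>2 = 0 \<longleftrightarrow> x = 0"
  by (simp add: quat_eq_iff add_nonneg_eq_0_iff)

instantiation quat :: real_inner
begin

definition "inner x y = qre x * qre y + qim1 x * qim1 y + qim2 x * qim2 y + qim3 x * qim3 y"
definition "norm x = sqrt ((qre x)\<^sup>2 + (qim1 x)\<^sup>2 + (qim2 x)\<^sup>2 + (qim3 x)\<^sup>2)"
definition "sgn (x::quat) = x /\<^sub>R norm x"
definition "dist (x::quat) y = norm (x - y)"
definition [code del]:
  "(uniformity :: (quat \<times> quat) filter) = (INF e\<in>{0 <..}. principal {(x, y). dist x y < e})"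
definition [code del]:
  "open (U :: quat set) \<longleftrightarrow> (\<forall>x\<in>U. eventually (\<lambda>(x', y). x' = x \<longrightarrow> y \<in> U) uniformity)"

instance
proof
  fix x y z :: quat and r :: real
  show "inner x x = 0 \<longleftrightarrow> x = 0"
    using quat_sum_squares_eq_0_iff[of x] by (simp add: inner_quat_def power2_eq_square)
qed (simp_all add: inner_quat_def norm_quat_def sgn_quat_def dist_quat_def
      uniformity_quat_def open_quat_def algebra_simps power2_eq_square)

end

instantiation quat :: real_normed_div_algebra
begin

definition "inverse x = qcnj x /\<^sub>R ((qre x)\<^sup>2 + (qim1 x)\<^sup>2 + (qim2 x)\<^sup>2 + (qim3 x)\<^sup>2)"
definition "x div (y::quat) = x * inverse y"

instance
proof
  fix x y :: quat
  show "norm (x * y) = norm x * norm y"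
    unfolding norm_quat_def real_sqrt_mult[symmetric]
    by (rule arg_cong[where f = sqrt]) (simp add: power2_eq_square algebra_simps)
  let ?N = "(qre x)\<^sup>2 + (qim1 x)\<^sup>2 + (qim2 x)\<^sup>2 + (qim3 x)\<^sup>2"
  {
    assume "x \<noteq> 0"
    then have N: "?N \<noteq> 0" using quat_sum_squares_eq_0_iff by blast
    have "qcnj x * x = ?N *\<^sub>R 1" "x * qcnj x = ?N *\<^sub>R 1"
      by (simp_all add: quat_eq_iff power2_eq_square)
    with N show "inverse x * x = 1" "x * inverse x = 1"
      by (simp_all add: inverse_quat_def)
  }
qed (simp_all add: divide_quat_def inverse_quat_def)

end

text \<open>The complex numbers as the subset $\{a_0 + a_1 i\}$ of the quaternions.\<close>

definition quat_complex :: "quat set"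
  where "quat_complex = {Quat a0 a1 0 0 | a0 a1. True}"


section \<open>Stability of quaternion matrix polynomials\<close>

text \<open>
  The product $z^* w$ of the conjugate transpose of a column vector $z$ with a column vector $w$.
  By associativity $z^* A y$ is $z^*$ applied to \<open>A *v y\<close>.
\<close>

definition conj_transpose_mult :: "quat ^ 'n \<Rightarrow> quat ^ 'n \<Rightarrow> quat"
  where "conj_transpose_mult z w = (\<Sum>k\<in>UNIV. qcnj (z $ k) * w $ k)"

text \<open>
  The matrix polynomial $\sum_{i=0}^m A_i \lambda^i$ is given by \<open>m\<close> and its coefficients
  \<open>A 0, \<dots>, A m\<close>; values of \<open>A\<close> beyond \<open>m\<close> are irrelevant. As the quaternions do not commute,
  the powers of \<open>\<mu>\<close> stand to the right of $z^* A_i y$.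
\<close>

definition stable_wrt :: "quat set \<Rightarrow> nat \<Rightarrow> (nat \<Rightarrow> quat ^ 'n ^ 'n) \<Rightarrow> bool"
  where "stable_wrt S m A \<longleftrightarrow>
    (\<forall>y. y \<noteq> 0 \<longrightarrow> (\<forall>\<mu>\<in>S. \<exists>z. z \<noteq> 0 \<and>
      (\<Sum>i\<le>m. conj_transpose_mult z (A i *v y) * \<mu> ^ i) \<noteq> 0))"

end

theory Submission
  imports Defs
begin

text \<open>
  Only the passage from \<open>ball a r \<inter> quat_complex\<close> to \<open>ball a r\<close> needs an argument. Every quaternion
  $\mu$ is similar to each complex number $\nu$ with the same real part and modulus, say
  $\mu q = q \nu$ with $q \neq 0$ (\<open>quat_similar_to_complex\<close>). Of the two such $\nu$, which are complex
  conjugates, the one on the same side of the real axis as $a$ satisfies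
  $|\nu - a| \le |\mu - a|$ (\<open>quat_similar_to_closer_complex\<close>), so it lies in the ball if
  $\mu$ does. Finally
  \[ \Bigl(\sum_i z^* A_i y \mu^i\Bigr) q = \sum_i z^* A_i (y q) \nu^i, \]
  so a vector $z$ that witnesses stability for the pair $(y q, \nu)$ witnesses it for $(y, \mu)$.
\<close>

lemma quat_similar_to_complex:
  assumes "\<nu> \<in> quat_complex" and re: "qre \<mu> = qre \<nu>" and nrm: "norm \<mu> = norm \<nu>"
  shows "\<exists>q. q \<noteq> 0 \<and> \<mu> * q = q * \<nu>"
proof (cases "\<mu> = qcnj \<nu>")
  case True
  \<comment> \<open>Conjugation by $j$ maps a complex number to its complex conjugate.\<close>
  from assms(1) obtain c d where "\<nu> = Quat c d 0 0"
    by (auto simp: quat_complex_def)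
  with True have "Quat 0 0 1 0 \<noteq> 0 \<and> \<mu> * Quat 0 0 1 0 = Quat 0 0 1 0 * \<nu>"
    by (simp add: quat_eq_iff)
  then show ?thesis by blast
next
  case False
  have sq: "(qim1 \<mu>)\<^sup>2 + (qim2 \<mu>)\<^sup>2 + (qim3 \<mu>)\<^sup>2 = (qim1 \<nu>)\<^sup>2 + (qim2 \<nu>)\<^sup>2 + (qim3 \<nu>)\<^sup>2"
    using nrm re by (simp add: norm_quat_def)
  \<comment> \<open>The two sides of the next equation differ by $\mu^2 - 2 \mathrm{Re}(\mu) \mu + |\mu|^2 = 0$.\<close>
  have "\<mu> * (\<mu> - qcnj \<nu>) = (\<mu> - qcnj \<nu>) * \<nu>"
  proof -
    have "qcnj \<nu> * \<nu> = \<mu> * qcnj \<mu>"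
      using re sq by (simp add: quat_eq_iff power2_eq_square)
    moreover have "\<mu> * qcnj \<nu> + \<mu> * \<nu> = \<mu> * \<mu> + \<mu> * qcnj \<mu>"
      by (simp add: quat_eq_iff re algebra_simps)
    ultimately show ?thesis by (simp add: algebra_simps)
  qed
  with False show ?thesis
    by (intro exI[of _ "\<mu> - qcnj \<nu>"]) simp
qed

lemma quat_similar_to_closer_complex:
  assumes "a \<in> quat_complex"
  obtains \<nu> q where "\<nu> \<in> quat_complex" "norm (\<nu> - a) \<le> norm (\<mu> - a)" "q \<noteq> 0" "\<mu> * q = q * \<nu>"
proof -
  obtain a0 a1 where a: "a = Quat a0 a1 0 0"
    using assms by (auto simp: quat_complex_def)
  define t where "t = sqrt ((qim1 \<mu>)\<^sup>2 + (qim2 \<mu>)\<^sup>2 + (qim3 \<mu>)\<^sup>2)"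
  have t2: "t\<^sup>2 = (qim1 \<mu>)\<^sup>2 + (qim2 \<mu>)\<^sup>2 + (qim3 \<mu>)\<^sup>2"
    by (simp add: t_def)
  have t: "\<bar>qim1 \<mu>\<bar> \<le> t"
    unfolding t_def by (rule real_le_rsqrt) simp
  define s :: real where "s = (if a1 \<ge> 0 then 1 else -1)"
  have s: "s\<^sup>2 = 1" "s * a1 = \<bar>a1\<bar>"
    by (auto simp: s_def)
  define \<nu> where "\<nu> = Quat (qre \<mu>) (s * t) 0 0"
  have \<nu>: "\<nu> \<in> quat_complex"
    by (auto simp: \<nu>_def quat_complex_def)
  have re: "qre \<mu> = qre \<nu>"
    by (simp add: \<nu>_def)
  have nrm: "norm \<mu> = norm \<nu>"
    by (simp add: norm_quat_def \<nu>_def power_mult_distrib s t2)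
  obtain q where q: "q \<noteq> 0" "\<mu> * q = q * \<nu>"
    using quat_similar_to_complex[OF \<nu> re nrm] by blast
  have "qim1 \<mu> * a1 \<le> \<bar>qim1 \<mu>\<bar> * \<bar>a1\<bar>"
    unfolding abs_mult[symmetric] by (rule abs_ge_self)
  also have "\<dots> \<le> t * \<bar>a1\<bar>"
    using t by (simp add: mult_right_mono)
  also have "\<dots> = (s * t) * a1"
    unfolding s(2)[symmetric] by (simp only: ac_simps)
  finally have le: "qim1 \<mu> * a1 \<le> (s * t) * a1" .
  have "(s * t - a1)\<^sup>2 = t\<^sup>2 - 2 * ((s * t) * a1) + a1\<^sup>2"
    by (simp add: power2_diff power_mult_distrib s)
  also have "\<dots> \<le> t\<^sup>2 - 2 * (qim1 \<mu> * a1) + a1\<^sup>2"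
    using le by simp
  also have "\<dots> = (qim1 \<mu> - a1)\<^sup>2 + (qim2 \<mu>)\<^sup>2 + (qim3 \<mu>)\<^sup>2"
    by (simp add: t2 power2_diff)
  finally have "norm (\<nu> - a) \<le> norm (\<mu> - a)"
    by (simp add: norm_quat_def \<nu>_def a)
  with \<nu> q show ?thesis using that by blast
qed

lemma conj_transpose_mult_right_scale:
  fixes B :: "quat ^ 'n ^ 'n"
  shows "conj_transpose_mult z (B *v (\<chi> k. y $ k * q)) = conj_transpose_mult z (B *v y) * q"
  by (simp add: conj_transpose_mult_def matrix_vector_mult_def sum_distrib_right mult.assoc
      sum_distrib_left)

lemma power_intertwine:
  fixes \<mu> \<nu> q :: "'a :: monoid_mult"
  assumes "\<mu> * q = q * \<nu>"
  shows "\<mu> ^ i * q = q * \<nu> ^ i"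
proof (induction i)
  case (Suc i)
  have "\<mu> ^ Suc i * q = \<mu> * (\<mu> ^ i * q)" by (simp add: mult.assoc)
  also have "\<dots> = \<mu> * q * \<nu> ^ i" by (simp add: Suc mult.assoc)
  also have "\<dots> = q * \<nu> ^ Suc i" by (simp add: assms mult.assoc)
  finally show ?case .
qed simp

theorem theorem4p12:
  fixes A :: "nat \<Rightarrow> quat ^ 'n ^ 'n" and m :: nat and a :: quat and r :: real
  assumes "A m \<noteq> 0"
    and "a \<in> quat_complex"
    and "r > 0"
  shows "stable_wrt (ball a r) m A \<longleftrightarrow> stable_wrt (ball a r \<inter> quat_complex) m A"
proof
  assume "stable_wrt (ball a r) m A"
  then show "stable_wrt (ball a r \<inter> quat_complex) m A"
    by (simp add: stable_wrt_def)
next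
  assume stable: "stable_wrt (ball a r \<inter> quat_complex) m A"
  show "stable_wrt (ball a r) m A"
    unfolding stable_wrt_def
  proof (intro allI impI ballI)
    fix y :: "quat ^ 'n" and \<mu>
    assume y: "y \<noteq> 0" and \<mu>: "\<mu> \<in> ball a r"
    obtain \<nu> q where \<nu>: "\<nu> \<in> quat_complex" "norm (\<nu> - a) \<le> norm (\<mu> - a)"
      and q: "q \<noteq> 0" "\<mu> * q = q * \<nu>"
      using quat_similar_to_closer_complex[OF assms(2)] by blast
    have ball: "\<nu> \<in> ball a r \<inter> quat_complex"
      using \<mu> \<nu> by (simp add: dist_norm norm_minus_commute)
    define y' where "y' = (\<chi> k. y $ k * q)"
    have "y' \<noteq> 0"
      using y q(1) by (auto simp: y'_def vec_eq_iff)
    with stable ball obtain z where z: "z \<noteq> 0"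
      "(\<Sum>i\<le>m. conj_transpose_mult z (A i *v y') * \<nu> ^ i) \<noteq> 0"
      unfolding stable_wrt_def by blast
    have "(\<Sum>i\<le>m. conj_transpose_mult z (A i *v y') * \<nu> ^ i)
        = (\<Sum>i\<le>m. conj_transpose_mult z (A i *v y) * \<mu> ^ i) * q"
      by (simp add: y'_def conj_transpose_mult_right_scale sum_distrib_right mult.assoc
          power_intertwine[OF q(2)])
    with z show "\<exists>z. z \<noteq> 0 \<and> (\<Sum>i\<le>m. conj_transpose_mult z (A i *v y) * \<mu> ^ i) \<noteq> 0"
      by auto
  qed
qed

end
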